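(* Let $\mathcal{A}$ be a C$^\ast$-algebra and let $K\subseteq[-1,1]$ be a set having $0$ as a limit point. Then: (i) Every element $F$ of $[\mathcal{A}]_K$ has a unique representation $F=a+G$, where $a\in\mathcal{A}$ and $G\in\hat{\mathcal{A}}_1$. (ii) $\|a\|_K=\|a\|\le\|a+G\|_K$ for all $a\in\mathcal{A}$ and $G\in\hat{\mathcal{A}}_1$. (iii) $[\mathcal{A}]_K$ is an extension of $\mathcal{A}$ by $\hat{\mathcal{A}}_1$. (iv) $\hat{\mathcal{A}}_1$ is not unital as a C$^\ast$-subalgebra of $[\mathcal{A}]_K$.
   Context: All C$^\ast$-algebras are complex. $\mathcal{A}[Z]$ is the $\ast$-algebra of all formal power series $F(Z)=\sum_{n=0}^\infty a_nZ^n$ with $a_n\in\mathcal{A}$ and $\sum_{n=0}^\infty\|a_n\|<\infty$, with coefficientwise linear operations, Cauchy product $(\sum a_nZ^n)(\sum b_nZ^n)=\sum_n(\sum_{k=0}^n a_kb_{n-k})Z^n$, and involution $(\sum a_nZ^n)^\ast=\sum a_n^\ast Z^n$. For $t\in[-1,1]$, $F(t)=\sum_{n=0}^\infty a_nt^n\in\mathcal{A}$. The norm $\|F\|_K=\sup_{t\in K}\|F(t)\|$ makes $\mathcal{A}[Z]$ a pre-C$^\ast$-algebra, and its completion is the C$^\ast$-algebra $[\mathcal{A}]_K$ (norm still denoted $\|\cdot\|_K$). $\mathcal{A}$ is identified with the subalgebra of constant series in $\mathcal{A}[Z]$. The ideal $\mathcal{A}_1=\{\sum a_nZ^n\in\mathcal{A}[Z]:a_0=0\}$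 has completion (closure in $[\mathcal{A}]_K$) denoted $\hat{\mathcal{A}}_1$; it is a closed ideal of $[\mathcal{A}]_K$. For C$^\ast$-algebras $\mathcal{A},\mathcal{B},\mathcal{E}$ with $\mathcal{B}$ an ideal of $\mathcal{E}$, $\mathcal{E}$ is an extension of $\mathcal{A}$ by $\mathcal{B}$ if there is a short exact sequence $0\to\mathcal{B}\overset{i}{\to}\mathcal{E}\overset{p}{\to}\mathcal{A}\to0$ with $i$ an injective and $p$ a surjective $\ast$-homomorphism and $i(\mathcal{B})=\ker p$. *)

theory Defs
  imports
    "HOL-Analysis.Analysis"
    "HOL-Computational_Algebra.Formal_Power_Series"
    "HOL-Probability.Discrete_Topology"
begin

unbundle no vec_syntax
unbundle fps_syntax

section \<open>C*-algebras\<close>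

text \<open>
  Algebras are not required to have a unit.
\<close>

class complex_star_algebra = ring +
  fixes scaleC :: "complex \<Rightarrow> 'a \<Rightarrow> 'a" (infixr \<open>*\<^sub>C\<close> 75)
    and star :: "'a \<Rightarrow> 'a"
  assumes scaleC_add_right: "c *\<^sub>C (x + y) = c *\<^sub>C x + c *\<^sub>C y"
    and scaleC_add_left: "(c + d) *\<^sub>C x = c *\<^sub>C x + d *\<^sub>C x"
    and scaleC_scaleC: "c *\<^sub>C d *\<^sub>C x = (c * d) *\<^sub>C x"
    and scaleC_one: "1 *\<^sub>C x = x"
    and mult_scaleC_left: "(c *\<^sub>C x) * y = c *\<^sub>C (x * y)"
    and mult_scaleC_right: "x * (c *\<^sub>C y) = c *\<^sub>C (x * y)"
    and star_add: "star (x + y) = star x + star y"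
    and star_scaleC: "star (c *\<^sub>C x) = cnj c *\<^sub>C star x"
    and star_mult: "star (x * y) = star y * star x"
    and star_star: "star (star x) = x"

class cstar_algebra = complex_star_algebra + real_normed_algebra + banach +
  assumes scaleR_eq_scaleC: "r *\<^sub>R x = complex_of_real r *\<^sub>C x"
    and norm_scaleC: "norm (c *\<^sub>C x) = cmod c * norm x"
    and cstar_identity: "norm (star x * x) = norm x ^ 2"

definition star_subalgebra :: "'a::complex_star_algebra set \<Rightarrow> bool" where
  "star_subalgebra S \<longleftrightarrow> 0 \<in> S \<and>
     (\<forall>x\<in>S. \<forall>y\<in>S. x + y \<in> S \<and> x * y \<in> S) \<and> (\<forall>x\<in>S. (\<forall>c. c *\<^sub>C x \<in> S) \<and> star x \<in> S)"

text \<open>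
  A norm-closed star-subalgebra is a C*-algebra in its own right. This lets C*-algebras that
  depend on a parameter be treated as subsets of a type.
\<close>

definition cstar_subalgebra :: "'a::cstar_algebra set \<Rightarrow> bool" where
  "cstar_subalgebra S \<longleftrightarrow> star_subalgebra S \<and> closed S"

definition two_sided_ideal :: "'a::complex_star_algebra set \<Rightarrow> 'a set \<Rightarrow> bool" where
  "two_sided_ideal B E \<longleftrightarrow> B \<subseteq> E \<and> 0 \<in> B \<and>
     (\<forall>x\<in>B. \<forall>y\<in>B. x + y \<in> B) \<and> (\<forall>x\<in>B. \<forall>c. c *\<^sub>C x \<in> B) \<and>
     (\<forall>x\<in>E. \<forall>y\<in>B. x * y \<in> B \<and> y * x \<in> B)"

definition star_hom_on ::
    "'a::complex_star_algebra set \<Rightarrow> 'b::complex_star_algebra set \<Rightarrow> ('a \<Rightarrow> 'b) \<Rightarrow> bool" where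
  "star_hom_on A B f \<longleftrightarrow> f ` A \<subseteq> B \<and>
     (\<forall>x\<in>A. \<forall>y\<in>A. f (x + y) = f x + f y \<and> f (x * y) = f x * f y) \<and>
     (\<forall>x\<in>A. (\<forall>c. f (c *\<^sub>C x) = c *\<^sub>C f x) \<and> f (star x) = star (f x))"

definition cstar_extension ::
    "'e::cstar_algebra set \<Rightarrow> 'a::cstar_algebra set \<Rightarrow> 'e set \<Rightarrow> bool" where
  "cstar_extension E A B \<longleftrightarrow>
     cstar_subalgebra E \<and> cstar_subalgebra A \<and> cstar_subalgebra B \<and> two_sided_ideal B E \<and>
     (\<exists>i p. star_hom_on B E i \<and> inj_on i B \<and> star_hom_on E A p \<and> p ` E = A \<and>
            i ` B = {x \<in> E. p x = 0})"

text \<open>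
  A unit is required to be nonzero, as in the class \<^class>\<open>zero_neq_one\<close>: the zero algebra does
  not count as unital.
\<close>

definition is_unital :: "'a::complex_star_algebra set \<Rightarrow> bool" where
  "is_unital S \<longleftrightarrow> (\<exists>e\<in>S. e \<noteq> 0 \<and> (\<forall>x\<in>S. e * x = x \<and> x * e = x))"

text \<open>
  \<open>E\<close> together with \<open>j\<close> is a completion of the star-algebra \<open>V\<close> with respect to the
  pre-C*-norm \<open>nrm\<close>. As a closed subset of a complete space, \<open>E\<close> is complete.
\<close>

definition cstar_completion ::
    "'v::complex_star_algebra set \<Rightarrow> ('v \<Rightarrow> real) \<Rightarrow> 'e::cstar_algebra set \<Rightarrow> ('v \<Rightarrow> 'e) \<Rightarrow> bool"
  where
  "cstar_completion V nrm E j \<longleftrightarrow>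
     star_hom_on V E j \<and> (\<forall>x\<in>V. norm (j x) = nrm x) \<and> closure (j ` V) = E"


section \<open>Power series with absolutely summable coefficients\<close>

lemma star_zero [simp]: "star (0::'a::complex_star_algebra) = 0"
  using star_add[of "0::'a" 0] by simp

lemma star_sum: "star (sum f I) = (\<Sum>i\<in>I. star (f i :: 'a::complex_star_algebra))"
  by (induction I rule: infinite_finite_induct) (simp_all add: star_add)

lemma scaleC_zero [simp]: "c *\<^sub>C (0::'a::complex_star_algebra) = 0"
  using scaleC_add_right[of c "0::'a" 0] by simp

lemma scaleC_sum: "c *\<^sub>C sum f I = (\<Sum>i\<in>I. c *\<^sub>C (f i :: 'a::complex_star_algebra))"
  by (induction I rule: infinite_finite_induct) (simp_all add: scaleC_add_right)

instantiation fps :: (complex_star_algebra) complex_star_algebra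
begin

definition scaleC_fps :: "complex \<Rightarrow> 'a fps \<Rightarrow> 'a fps" where
  "c *\<^sub>C F = Abs_fps (\<lambda>n. c *\<^sub>C (F $ n))"

definition star_fps :: "'a fps \<Rightarrow> 'a fps" where
  "star F = Abs_fps (\<lambda>n. star (F $ n))"

instance
proof
  fix c d :: complex and F G :: "'a fps"
  show "star (F * G) = star G * star F"
  proof (rule fps_ext)
    fix n
    have "star (F * G) $ n = (\<Sum>i=0..n. star (G $ (n - i)) * star (F $ i))"
      by (simp add: star_fps_def fps_mult_nth star_sum star_mult)
    also have "\<dots> = (\<Sum>i=0..n. star (G $ i) * star (F $ (n - i)))"
      by (rule sum.reindex_bij_witness[of _ "\<lambda>i. n - i" "\<lambda>i. n - i"]) auto
    finally show "star (F * G) $ n = (star G * star F) $ n"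
      by (simp add: star_fps_def fps_mult_nth)
  qed
qed (auto intro!: fps_ext simp: scaleC_fps_def star_fps_def fps_mult_nth scaleC_sum
       scaleC_add_right scaleC_add_left scaleC_scaleC scaleC_one mult_scaleC_left
       mult_scaleC_right star_add star_scaleC star_star)

end

definition abs_summable_fps :: "'a::real_normed_vector fps set" where
  "abs_summable_fps = {F. summable (\<lambda>n. norm (F $ n))}"

definition abs_summable_fps1 :: "'a::real_normed_vector fps set" where
  "abs_summable_fps1 = {F \<in> abs_summable_fps. F $ 0 = 0}"

definition fps_val :: "'a::real_normed_vector fps \<Rightarrow> real \<Rightarrow> 'a" where
  "fps_val F t = (\<Sum>n. t ^ n *\<^sub>R (F $ n))"

definition norm_on :: "real set \<Rightarrow> 'a::real_normed_vector fps \<Rightarrow> real" where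
  "norm_on K F = (SUP t\<in>K. norm (fps_val F t))"


section \<open>Existence of the completion\<close>

text \<open>
  The completion is unique up to isometric star-isomorphism, so statements about it are made for
  an arbitrary one. That there is one is shown here, inside the C*-algebra of all bounded functions
  from the reals to the given algebra.
\<close>

lemma norm_star: "norm (star x) = norm (x :: 'a::cstar_algebra)"
proof -
  have le: "norm y \<le> norm (star y)" for y :: 'a
  proof (cases "y = 0")
    case False
    have "norm y * norm y \<le> norm (star y) * norm y"
      using norm_mult_ineq[of "star y" y] by (simp add: cstar_identity power2_eq_square)
    with False show ?thesis by simp
  qed simp
  from le[of x] le[of "star x"] show ?thesis by (simp add: star_star)
qed

lemma star_scaleR: "star (r *\<^sub>R x) = r *\<^sub>R star (x :: 'a::cstar_algebra)"
  by (simp add: scaleR_eq_scaleC star_scaleC)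

lemma bounded_linear_star: "bounded_linear (star :: 'a::cstar_algebra \<Rightarrow> 'a)"
  by (rule bounded_linear_intro[of _ 1]) (simp_all add: star_add star_scaleR norm_star)

lemma scaleC_scaleR: "c *\<^sub>C (r *\<^sub>R x) = r *\<^sub>R (c *\<^sub>C (x :: 'a::cstar_algebra))"
  by (simp add: scaleR_eq_scaleC scaleC_scaleC mult.commute)

lemma bounded_linear_scaleC: "bounded_linear ((*\<^sub>C) c :: 'a::cstar_algebra \<Rightarrow> 'a)"
  by (rule bounded_linear_intro[of _ "cmod c"])
     (simp_all add: scaleC_add_right norm_scaleC scaleC_scaleR mult.commute)

lemma norm_power_scaleR_le:
  assumes "\<bar>t\<bar> \<le> (1::real)"
  shows "norm (t ^ n *\<^sub>R x) \<le> norm (x :: 'a::real_normed_vector)"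
  using mult_right_mono[of "\<bar>t\<bar> ^ n" 1 "norm x"] power_le_one[of "\<bar>t\<bar>" n] assms
  by (simp add: power_abs)

lemma summable_fps_val:
  fixes F :: "'a::banach fps"
  assumes "F \<in> abs_summable_fps" "\<bar>t\<bar> \<le> 1"
  shows "summable (\<lambda>n. norm (t ^ n *\<^sub>R (F $ n)))" "summable (\<lambda>n. t ^ n *\<^sub>R (F $ n))"
proof -
  show "summable (\<lambda>n. norm (t ^ n *\<^sub>R (F $ n)))"
    by (rule summable_comparison_test'[of "\<lambda>n. norm (F $ n)" 0])
       (use assms in \<open>simp_all add: abs_summable_fps_def norm_power_scaleR_le del: norm_scaleR\<close>)
  then show "summable (\<lambda>n. t ^ n *\<^sub>R (F $ n))"
    by (rule summable_norm_cancel)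
qed

lemma norm_fps_val_le:
  fixes F :: "'a::banach fps"
  assumes "F \<in> abs_summable_fps" "\<bar>t\<bar> \<le> 1"
  shows "norm (fps_val F t) \<le> (\<Sum>n. norm (F $ n))"
proof -
  have "norm (fps_val F t) \<le> (\<Sum>n. norm (t ^ n *\<^sub>R (F $ n)))"
    unfolding fps_val_def by (rule summable_norm) (rule summable_fps_val(1)[OF assms])
  also have "\<dots> \<le> (\<Sum>n. norm (F $ n))"
    by (intro suminf_le norm_power_scaleR_le summable_fps_val assms)
       (use assms in \<open>simp add: abs_summable_fps_def\<close>)
  finally show ?thesis .
qed

lemma fps_val_add:
  fixes F G :: "'a::banach fps"
  assumes "F \<in> abs_summable_fps" "G \<in> abs_summable_fps" "\<bar>t\<bar> \<le> 1"
  shows "fps_val (F + G) t = fps_val F t + fps_val G t"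
  using assms by (simp add: fps_val_def scaleR_add_right suminf_add summable_fps_val)

lemma fps_val_mult:
  fixes F G :: "'a::{real_normed_algebra, banach} fps"
  assumes "F \<in> abs_summable_fps" "G \<in> abs_summable_fps" "\<bar>t\<bar> \<le> 1"
  shows "fps_val (F * G) t = fps_val F t * fps_val G t"
proof -
  have "fps_val F t * fps_val G t =
      (\<Sum>k. \<Sum>i\<le>k. (t ^ i *\<^sub>R (F $ i)) * (t ^ (k - i) *\<^sub>R (G $ (k - i))))"
    unfolding fps_val_def by (intro Cauchy_product summable_fps_val assms)
  also have "\<dots> = fps_val (F * G) t"
    unfolding fps_val_def
    by (intro suminf_cong)
       (auto simp: fps_mult_nth scaleR_sum_right atLeast0AtMost power_add[symmetric]
             intro!: sum.cong)
  finally show ?thesis ..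
qed

lemma fps_val_scaleC:
  fixes F :: "'a::cstar_algebra fps"
  assumes "F \<in> abs_summable_fps" "\<bar>t\<bar> \<le> 1"
  shows "fps_val (c *\<^sub>C F) t = c *\<^sub>C fps_val F t"
  using bounded_linear.suminf[OF bounded_linear_scaleC summable_fps_val(2)[OF assms], of c]
  by (simp add: fps_val_def scaleC_fps_def scaleC_scaleR)

lemma fps_val_star:
  fixes F :: "'a::cstar_algebra fps"
  assumes "F \<in> abs_summable_fps" "\<bar>t\<bar> \<le> 1"
  shows "fps_val (star F) t = star (fps_val F t)"
  using bounded_linear.suminf[OF bounded_linear_star summable_fps_val(2)[OF assms]]
  by (simp add: fps_val_def star_fps_def star_scaleR)

lemma apply_Bcontfun:
  fixes f :: "'t::topological_space \<Rightarrow> 'a::real_normed_vector"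
  assumes "continuous_on UNIV f" "\<And>x. norm (f x) \<le> b"
  shows "apply_bcontfun (Bcontfun f) = f"
  using assms by (intro Bcontfun_inverse bcontfun_normI)

instantiation bcontfun :: (topological_space, real_normed_algebra) real_normed_algebra
begin

definition times_bcontfun ::
    "('a \<Rightarrow>\<^sub>C 'b) \<Rightarrow> ('a \<Rightarrow>\<^sub>C 'b) \<Rightarrow> ('a \<Rightarrow>\<^sub>C 'b)" where
  "f * g = Bcontfun (\<lambda>x. apply_bcontfun f x * apply_bcontfun g x)"

lemma norm_apply_mult_le:
  "norm (apply_bcontfun f x * apply_bcontfun g x :: 'b) \<le> norm f * norm g"
  by (rule order_trans[OF norm_mult_ineq]) (intro mult_mono norm_bounded norm_ge_zero)

lemma apply_bcontfun_times [simp]: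
  "apply_bcontfun (f * g) x = apply_bcontfun f x * (apply_bcontfun g x :: 'b)"
  unfolding times_bcontfun_def
  by (subst apply_Bcontfun[OF _ norm_apply_mult_le]) (auto intro!: continuous_intros)

instance
proof
  fix f g :: "'a \<Rightarrow>\<^sub>C 'b"
  show "norm (f * g) \<le> norm f * norm g"
    by (rule norm_bound) (simp add: norm_apply_mult_le)
qed (auto intro!: bcontfun_eqI simp: algebra_simps)

end

instance bcontfun :: (metric_space, banach) banach ..

instantiation bcontfun :: (metric_space, cstar_algebra) cstar_algebra
begin

definition scaleC_bcontfun :: "complex \<Rightarrow> ('a \<Rightarrow>\<^sub>C 'b) \<Rightarrow> ('a \<Rightarrow>\<^sub>C 'b)" where
  "c *\<^sub>C f = Bcontfun (\<lambda>x. c *\<^sub>C apply_bcontfun f x)"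

definition star_bcontfun :: "('a \<Rightarrow>\<^sub>C 'b) \<Rightarrow> ('a \<Rightarrow>\<^sub>C 'b)" where
  "star f = Bcontfun (\<lambda>x. star (apply_bcontfun f x))"

lemma apply_bcontfun_scaleC [simp]:
  "apply_bcontfun (c *\<^sub>C f) x = c *\<^sub>C (apply_bcontfun f x :: 'b)"
  unfolding scaleC_bcontfun_def
  by (subst apply_Bcontfun[of _ "cmod c * norm f"])
     (auto intro!: bounded_linear.continuous_on[OF bounded_linear_scaleC] mult_left_mono norm_bounded
       simp: norm_scaleC)

lemma apply_bcontfun_star [simp]:
  "apply_bcontfun (star f) x = star (apply_bcontfun f x :: 'b)"
  unfolding star_bcontfun_def
  by (subst apply_Bcontfun[of _ "norm f"])
     (auto intro!: bounded_linear.continuous_on[OF bounded_linear_star] norm_bounded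
       simp: norm_star)

instance
proof
  fix c :: complex and f g :: "'a \<Rightarrow>\<^sub>C 'b" and r :: real
  have le: "norm (d *\<^sub>C h) \<le> cmod d * norm h" for d and h :: "'a \<Rightarrow>\<^sub>C 'b"
    by (rule norm_bound) (simp add: norm_scaleC mult_left_mono norm_bounded)
  show "norm (c *\<^sub>C f) = cmod c * norm f"
  proof (cases "c = 0")
    case True
    then show ?thesis using le[of c f] by simp
  next
    case False
    have "inverse c *\<^sub>C c *\<^sub>C f = f"
      using False by (auto intro!: bcontfun_eqI simp: scaleC_scaleC scaleC_one)
    with le[of "inverse c" "c *\<^sub>C f"] have "norm f \<le> norm (c *\<^sub>C f) / cmod c"
      by (simp add: norm_inverse divide_inverse mult.commute)
    with False le[of c f] show ?thesis by (simp add: field_simps)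
  qed
  have "norm f \<le> sqrt (norm (star f * f))"
  proof (rule norm_bound)
    fix x
    have "norm (apply_bcontfun f x) ^ 2 \<le> norm (star f * f)"
      using norm_bounded[of "star f * f" x] by (simp add: cstar_identity)
    then show "norm (apply_bcontfun f x) \<le> sqrt (norm (star f * f))"
      by (rule real_le_rsqrt)
  qed
  then have "norm f ^ 2 \<le> norm (star f * f)"
    using power_mono[of "norm f" "sqrt (norm (star f * f))" 2] by simp
  moreover have "norm (star f * f) \<le> norm f ^ 2"
    by (rule norm_bound) (simp add: cstar_identity power_mono norm_bounded)
  ultimately show "norm (star f * f) = norm f ^ 2" by simp
qed (auto intro!: bcontfun_eqI simp: scaleC_add_right scaleC_add_left scaleC_scaleC scaleC_one
       mult_scaleC_left mult_scaleC_right star_add star_scaleC star_mult star_star scaleR_eq_scaleC)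

end

lemma cstar_completion_exists:
  fixes K :: "real set"
  assumes "K \<subseteq> {-1..1}" "K \<noteq> {}"
  shows "\<exists>E (j :: 'a::cstar_algebra fps \<Rightarrow> real discrete \<Rightarrow>\<^sub>C 'a).
           cstar_completion abs_summable_fps (norm_on K) E j"
proof -
  define j :: "'a fps \<Rightarrow> real discrete \<Rightarrow>\<^sub>C 'a" where
    "j F = Bcontfun (\<lambda>d. if of_discrete d \<in> K then fps_val F (of_discrete d) else 0)" for F
  have K: "\<bar>t\<bar> \<le> 1" if "t \<in> K" for t
    using that assms by (auto simp: abs_le_iff)
  have j: "apply_bcontfun (j F) d = (if of_discrete d \<in> K then fps_val F (of_discrete d) else 0)"
    if F: "F \<in> abs_summable_fps" for F d
    unfolding j_def
  proof (subst apply_Bcontfun[of _ "\<Sum>n. norm (F $ n)"])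
    fix d :: "real discrete"
    show "norm (if of_discrete d \<in> K then fps_val F (of_discrete d) else 0) \<le> (\<Sum>n. norm (F $ n))"
      using F K[of "of_discrete d"]
      by (auto intro!: norm_fps_val_le suminf_nonneg simp: abs_summable_fps_def)
  qed (auto simp: continuous_on_open_vimage open_discrete)
  have F_add: "F + G \<in> abs_summable_fps"
    if "F \<in> abs_summable_fps" "G \<in> abs_summable_fps" for F G :: "'a fps"
    unfolding abs_summable_fps_def mem_Collect_eq
    by (rule summable_comparison_test'[of "\<lambda>n. norm (F $ n) + norm (G $ n)" 0])
       (use that in \<open>simp_all add: abs_summable_fps_def summable_add norm_triangle_ineq\<close>)
  have F_mult: "F * G \<in> abs_summable_fps"
    if "F \<in> abs_summable_fps" "G \<in> abs_summable_fps" for F G :: "'a fps"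
  proof -
    have "summable (\<lambda>k. \<Sum>i\<le>k. norm (F $ i) * norm (G $ (k - i)))"
      using that by (intro summable_Cauchy_product) (simp_all add: abs_summable_fps_def)
    moreover have "norm ((F * G) $ k) \<le> (\<Sum>i\<le>k. norm (F $ i) * norm (G $ (k - i)))" for k
      unfolding fps_mult_nth atLeast0AtMost
      by (rule order_trans[OF norm_sum]) (intro sum_mono norm_mult_ineq)
    ultimately show ?thesis
      unfolding abs_summable_fps_def mem_Collect_eq
      by - (rule summable_comparison_test'
              [of "\<lambda>k. \<Sum>i\<le>k. norm (F $ i) * norm (G $ (k - i))" 0], simp_all)
  qed
  have F_scaleC: "c *\<^sub>C F \<in> abs_summable_fps" if "F \<in> abs_summable_fps" for c and F :: "'a fps"
    using that by (simp add: abs_summable_fps_def scaleC_fps_def norm_scaleC summable_mult)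
  have F_star: "star F \<in> abs_summable_fps" if "F \<in> abs_summable_fps" for F :: "'a fps"
    using that by (simp add: abs_summable_fps_def star_fps_def norm_star)
  have "norm (j F) = norm_on K F" if F: "F \<in> abs_summable_fps" for F
  proof (rule antisym)
    have bdd: "bdd_above ((\<lambda>t. norm (fps_val F t)) ` K)"
      using F K by (intro bdd_aboveI2[of _ _ "\<Sum>n. norm (F $ n)"] norm_fps_val_le)
    have up: "norm (fps_val F t) \<le> norm_on K F" if "t \<in> K" for t
      unfolding norm_on_def using bdd that by (rule cSUP_upper2) simp
    obtain t where "t \<in> K" using assms by blast
    with up have "0 \<le> norm_on K F" using norm_ge_zero order_trans by blast
    with up show "norm (j F) \<le> norm_on K F"
      by (intro norm_bound) (auto simp: j F)
    show "norm_on K F \<le> norm (j F)"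
      unfolding norm_on_def
    proof (rule cSUP_least)
      fix t assume "t \<in> K"
      then show "norm (fps_val F t) \<le> norm (j F)"
        using norm_bounded[of "j F" "discrete t"] by (simp add: j F discrete_inverse)
    qed (use assms in simp)
  qed
  moreover have "star_hom_on abs_summable_fps (closure (j ` abs_summable_fps)) j"
    unfolding star_hom_on_def
    by (auto intro!: bcontfun_eqI closure_subset[THEN subsetD]
        simp: j F_add F_mult F_scaleC F_star K fps_val_add fps_val_mult fps_val_scaleC fps_val_star)
  ultimately show ?thesis
    unfolding cstar_completion_def by blast
qed

end

theory Submission
  imports Defs
begin

text \<open>
  Since \<open>0\<close> is a limit point of \<open>K\<close>, continuity gives \<open>\<parallel>F(0)\<parallel> \<le> \<parallel>F\<parallel>\<^sub>K\<close>, so evaluation at \<open>0\<close>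
  extends to a contractive star-homomorphism on the completion. It is a left inverse of the
  embedding of the constants and its kernel is the closure of the series without constant term,
  which yields (i)--(iii). For (iv), evaluating a unit \<open>e\<close> of the kernel at \<open>t \<in> K\<close>
  gives an idempotent whose norm is less than \<open>1\<close>, hence which is \<open>0\<close>, once \<open>t\<close> is close to \<open>0\<close>.
  Then \<open>e\<close> cannot act as a unit on \<open>a Z\<close>, whose value at \<open>t\<close> is \<open>t a\<close>.
\<close>

section \<open>Star-subalgebras and star-homomorphisms\<close>

lemma scaleC_minus_one: "(-1) *\<^sub>C x = - (x :: 'a::complex_star_algebra)"
proof -
  have "0 *\<^sub>C x = 0"
    using scaleC_add_left[of 0 0 x] by simp
  then have "(-1) *\<^sub>C x + x = 0"
    using scaleC_add_left[of "-1" 1 x] by (simp add: scaleC_one)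
  then show ?thesis
    by (simp add: eq_neg_iff_add_eq_0)
qed

text \<open>The definitions speak of sums and scalar multiples only; differences are reached through
  the scalar -1, here and in \<open>star_hom_on_diff\<close>.\<close>

lemma star_subalgebra_diff:
  assumes "star_subalgebra S" "x \<in> S" "y \<in> S"
  shows "x - y \<in> S"
proof -
  have "x + (-1) *\<^sub>C y \<in> S"
    using assms unfolding star_subalgebra_def by blast
  then show ?thesis
    by (simp add: scaleC_minus_one)
qed

lemma star_hom_on_diff:
  assumes "star_hom_on S B f" "star_subalgebra S" "x \<in> S" "y \<in> S"
  shows "f (x - y) = f x - f y"
proof -
  have "(-1) *\<^sub>C y \<in> S"
    using assms unfolding star_subalgebra_def by blast
  then have "f (x + (-1) *\<^sub>C y) = f x + (-1) *\<^sub>C f y"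
    using assms unfolding star_hom_on_def by metis
  then show ?thesis
    by (simp add: scaleC_minus_one)
qed

lemma star_hom_on_zero:
  assumes "star_hom_on S B f" "star_subalgebra S"
  shows "f 0 = 0"
  using star_hom_on_diff[OF assms, of 0 0] assms(2) by (simp add: star_subalgebra_def)

lemma star_hom_on_image:
  assumes "star_hom_on S B f" "star_subalgebra S"
  shows "star_subalgebra (f ` S)"
proof -
  have "0 \<in> f ` S"
    using star_hom_on_zero[OF assms] assms(2) unfolding star_subalgebra_def by (metis image_eqI)
  moreover have "f x + f y \<in> f ` S" "f x * f y \<in> f ` S" "c *\<^sub>C f x \<in> f ` S" "star (f x) \<in> f ` S"
    if "x \<in> S" "y \<in> S" for x y c
    using assms that unfolding star_hom_on_def star_subalgebra_def by (metis image_eqI)+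
  ultimately show ?thesis
    unfolding star_subalgebra_def by blast
qed

lemma star_hom_on_kernel:
  assumes "star_hom_on S B f" "star_subalgebra S"
  shows "star_subalgebra {x \<in> S. f x = 0}" "two_sided_ideal {x \<in> S. f x = 0} S"
  using star_hom_on_zero[OF assms] assms
  unfolding star_hom_on_def star_subalgebra_def two_sided_ideal_def by auto

section \<open>Closures and extension to a completion\<close>

lemma closure_star_subalgebra:
  fixes S :: "'a::cstar_algebra set"
  assumes "star_subalgebra S"
  shows "cstar_subalgebra (closure S)"
proof -
  have "0 \<in> closure S"
    using assms closure_subset by (auto simp: star_subalgebra_def)
  moreover have "x + y \<in> closure S \<and> x * y \<in> closure S"
    if xy: "x \<in> closure S" "y \<in> closure S" for x y
  proof -
    obtain u v where "\<And>n. u n \<in> S" "u \<longlonglongrightarrow> x" "\<And>n. v n \<in> S" "v \<longlonglongrightarrow> y"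
      using xy unfolding closure_sequential by blast
    then show ?thesis
      using assms unfolding closure_sequential star_subalgebra_def
      by (intro conjI exI[of _ "\<lambda>n. u n + v n"] exI[of _ "\<lambda>n. u n * v n"])
         (auto intro: tendsto_add tendsto_mult)
  qed
  moreover have "c *\<^sub>C x \<in> closure S \<and> star x \<in> closure S" if x: "x \<in> closure S" for x c
  proof -
    obtain u where "\<And>n. u n \<in> S" "u \<longlonglongrightarrow> x"
      using x unfolding closure_sequential by blast
    then show ?thesis
      using assms unfolding closure_sequential star_subalgebra_def
      by (intro conjI exI[of _ "\<lambda>n. c *\<^sub>C u n"] exI[of _ "\<lambda>n. star (u n)"])
         (auto intro: bounded_linear.tendsto[OF bounded_linear_star]
                      bounded_linear.tendsto[OF bounded_linear_scaleC])
  qed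
  ultimately show ?thesis
    unfolding cstar_subalgebra_def star_subalgebra_def by auto
qed

text \<open>The bound makes \<open>f x\<close> a 1-Lipschitz function of \<open>j x\<close>. The
  image of \<open>V\<close> is dense in \<open>E\<close>, so this function extends by uniform
  continuity, and the algebraic identities and the norm bound survive in the limit. The lemma serves
  to evaluate elements of the completion at a point.\<close>

lemma star_hom_extends_to_completion:
  fixes j :: "'v::complex_star_algebra \<Rightarrow> 'e::cstar_algebra" and f :: "'v \<Rightarrow> 'b::cstar_algebra"
  assumes V: "star_subalgebra V"
    and compl: "cstar_completion V nrm E j"
    and f: "star_hom_on V UNIV f"
    and le: "\<And>x. x \<in> V \<Longrightarrow> norm (f x) \<le> nrm x"
  obtains p where "star_hom_on E UNIV p" "continuous_on E p" "\<And>x. x \<in> V \<Longrightarrow> p (j x) = f x"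
    "\<And>y. y \<in> E \<Longrightarrow> norm (p y) \<le> norm y"
proof -
  have j: "star_hom_on V E j" and nj: "\<And>x. x \<in> V \<Longrightarrow> norm (j x) = nrm x"
    and E: "closure (j ` V) = E"
    using compl by (auto simp: cstar_completion_def)
  have dist_le: "dist (f x) (f y) \<le> dist (j x) (j y)" if "x \<in> V" "y \<in> V" for x y
    using le[of "x - y"] nj[of "x - y"] star_subalgebra_diff[OF V that]
      star_hom_on_diff[OF f V that] star_hom_on_diff[OF j V that]
    by (simp add: dist_norm)
  have jV: "j x \<in> E" if "x \<in> V" for x
    using that E closure_subset[of "j ` V"] by auto
  \<comment> \<open>The choice of preimage is immaterial: by \<open>dist_le\<close>, elements of
    \<open>V\<close> with the same image under \<open>j\<close> have the same image under
    \<open>f\<close>.\<close>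
  define g where "g = (\<lambda>y. f (inv_into V j y))"
  have gj: "g (j x) = f x" if "x \<in> V" for x
    using dist_le[of "inv_into V j (j x)" x] that
    by (simp add: g_def f_inv_into_f inv_into_into)
  have "uniformly_continuous_on (j ` V) g"
    unfolding uniformly_continuous_on_def
    using dist_le by (auto simp: gj intro: le_less_trans)
  then obtain p where p: "uniformly_continuous_on (closure (j ` V)) p"
    "\<And>y. y \<in> j ` V \<Longrightarrow> g y = p y"
    using uniformly_continuous_on_extension_on_closure by metis
  have pj: "p (j x) = f x" if "x \<in> V" for x
    using p(2)[of "j x"] gj that by simp
  have cont: "continuous_on E p"
    using uniformly_continuous_imp_continuous[OF p(1)] E by simp
  have subE: "cstar_subalgebra E"
    using closure_star_subalgebra[OF star_hom_on_image[OF j V]] E by simp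
  have approx: "\<exists>u. (\<forall>n. u n \<in> V) \<and> (\<lambda>n. j (u n)) \<longlonglongrightarrow> y \<and> (\<lambda>n. f (u n)) \<longlonglongrightarrow> p y" if y: "y \<in> E" for y
  proof -
    obtain w where w: "\<And>n. w n \<in> j ` V" "w \<longlonglongrightarrow> y"
      using y unfolding E[symmetric] closure_sequential by blast
    have "\<forall>n. \<exists>v. v \<in> V \<and> w n = j v"
      using w(1) by blast
    from choice[OF this] obtain u where u: "\<And>n. u n \<in> V" "w = (\<lambda>n. j (u n))"
      by blast
    have "(\<lambda>n. p (w n)) \<longlonglongrightarrow> p y"
      by (intro continuous_on_tendsto_compose[OF cont w(2) y]) (simp add: u jV)
    then show ?thesis
      using w(2) u by (intro exI[of _ u]) (simp add: pj)
  qed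
  \<comment> \<open>Any approximating sequence may be used to compute \<open>p y\<close>. An
    identity for \<open>p\<close> thus follows from the same identity for \<open>j\<close> and
    \<open>f\<close> at each index.\<close>
  have lim: "p y = l" if "y \<in> E" "\<And>n. u n \<in> V" "(\<lambda>n. j (u n)) \<longlonglongrightarrow> y" "(\<lambda>n. f (u n)) \<longlonglongrightarrow> l" for u y l
  proof (rule LIMSEQ_unique)
    have "j (u n) \<in> E" for n
      using that(2) jV by blast
    then have "(\<lambda>n. p (j (u n))) \<longlonglongrightarrow> p y"
      by (intro continuous_on_tendsto_compose[OF cont that(3,1)]) auto
    then show "(\<lambda>n. f (u n)) \<longlonglongrightarrow> p y"
      by (simp add: pj that(2))
  qed fact
  have add_mult: "p (x + y) = p x + p y \<and> p (x * y) = p x * p y" if xy: "x \<in> E" "y \<in> E" for x y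
  proof -
    obtain u where u: "\<And>n. u n \<in> V" "(\<lambda>n. j (u n)) \<longlonglongrightarrow> x" "(\<lambda>n. f (u n)) \<longlonglongrightarrow> p x"
      using approx[OF xy(1)] by blast
    obtain v where v: "\<And>n. v n \<in> V" "(\<lambda>n. j (v n)) \<longlonglongrightarrow> y" "(\<lambda>n. f (v n)) \<longlonglongrightarrow> p y"
      using approx[OF xy(2)] by blast
    have mem: "x + y \<in> E" "x * y \<in> E" "\<And>n. u n + v n \<in> V" "\<And>n. u n * v n \<in> V"
      using subE V xy u(1) v(1) by (auto simp: cstar_subalgebra_def star_subalgebra_def)
    have hom: "j (u n + v n) = j (u n) + j (v n)" "f (u n + v n) = f (u n) + f (v n)"
      "j (u n * v n) = j (u n) * j (v n)" "f (u n * v n) = f (u n) * f (v n)" for n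
      using j f u(1) v(1) by (auto simp: star_hom_on_def)
    have "p (x + y) = p x + p y"
      by (rule lim[of _ "\<lambda>n. u n + v n"]) (auto simp: hom mem intro!: tendsto_add u v)
    moreover have "p (x * y) = p x * p y"
      by (rule lim[of _ "\<lambda>n. u n * v n"]) (auto simp: hom mem intro!: tendsto_mult u v)
    ultimately show ?thesis ..
  qed
  have scale_star: "p (c *\<^sub>C x) = c *\<^sub>C p x \<and> p (star x) = star (p x)" if x: "x \<in> E" for x c
  proof -
    obtain u where u: "\<And>n. u n \<in> V" "(\<lambda>n. j (u n)) \<longlonglongrightarrow> x" "(\<lambda>n. f (u n)) \<longlonglongrightarrow> p x"
      using approx[OF x] by blast
    have mem: "c *\<^sub>C x \<in> E" "star x \<in> E" "\<And>n. c *\<^sub>C u n \<in> V" "\<And>n. star (u n) \<in> V"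
      using subE V x u(1) by (auto simp: cstar_subalgebra_def star_subalgebra_def)
    have hom: "j (c *\<^sub>C u n) = c *\<^sub>C j (u n)" "f (c *\<^sub>C u n) = c *\<^sub>C f (u n)"
      "j (star (u n)) = star (j (u n))" "f (star (u n)) = star (f (u n))" for n
      using j f u(1) by (auto simp: star_hom_on_def)
    have "p (c *\<^sub>C x) = c *\<^sub>C p x"
      by (rule lim[of _ "\<lambda>n. c *\<^sub>C u n"])
         (auto simp: hom mem intro!: bounded_linear.tendsto[OF bounded_linear_scaleC] u)
    moreover have "p (star x) = star (p x)"
      by (rule lim[of _ "\<lambda>n. star (u n)"])
         (auto simp: hom mem intro!: bounded_linear.tendsto[OF bounded_linear_star] u)
    ultimately show ?thesis ..
  qed
  \<comment> \<open>Along the sequence, \<open>nrm (u n)\<close> bounds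
    \<open>norm (f (u n))\<close> and equals \<open>norm (j (u n))\<close>.\<close>
  have "norm (p y) \<le> norm y" if y: "y \<in> E" for y
  proof -
    obtain u where u: "\<And>n. u n \<in> V" "(\<lambda>n. j (u n)) \<longlonglongrightarrow> y" "(\<lambda>n. f (u n)) \<longlonglongrightarrow> p y"
      using approx[OF y] by blast
    show ?thesis
      by (rule LIMSEQ_le[OF tendsto_norm[OF u(3)] tendsto_norm[OF u(2)]])
         (use le nj u(1) in auto)
  qed
  then show ?thesis
    using that[of p] add_mult scale_star cont pj by (auto simp: star_hom_on_def)
qed

section \<open>Absolutely summable series and their values\<close>

lemma star_subalgebra_abs_summable_fps:
  "star_subalgebra (abs_summable_fps :: 'a::cstar_algebra fps set)"
proof -
  have "F + G \<in> abs_summable_fps"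
    if "F \<in> abs_summable_fps" "G \<in> abs_summable_fps" for F G :: "'a fps"
    unfolding abs_summable_fps_def mem_Collect_eq
    by (rule summable_comparison_test'[of "\<lambda>n. norm (F $ n) + norm (G $ n)" 0])
       (use that in \<open>simp_all add: abs_summable_fps_def summable_add norm_triangle_ineq\<close>)
  moreover have "F * G \<in> abs_summable_fps"
    if "F \<in> abs_summable_fps" "G \<in> abs_summable_fps" for F G :: "'a fps"
    unfolding abs_summable_fps_def mem_Collect_eq
  proof (rule summable_comparison_test')
    show "summable (\<lambda>k. \<Sum>i\<le>k. norm (F $ i) * norm (G $ (k - i)))"
      using that by (intro summable_Cauchy_product) (simp_all add: abs_summable_fps_def)
    show "norm (norm ((F * G) $ k)) \<le> (\<Sum>i\<le>k. norm (F $ i) * norm (G $ (k - i)))" for k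
      unfolding fps_mult_nth atLeast0AtMost real_norm_def abs_norm_cancel
      by (rule order_trans[OF norm_sum]) (intro sum_mono norm_mult_ineq)
  qed
  ultimately show ?thesis
    by (auto simp: star_subalgebra_def abs_summable_fps_def scaleC_fps_def star_fps_def
          norm_scaleC norm_star summable_mult)
qed

lemma star_hom_on_fps_val:
  assumes "\<bar>t\<bar> \<le> 1"
  shows "star_hom_on (abs_summable_fps :: 'a::cstar_algebra fps set) UNIV (\<lambda>F. fps_val F t)"
  using assms
  by (simp add: star_hom_on_def fps_val_add fps_val_mult fps_val_scaleC fps_val_star)

text \<open>On the whole interval the terms are dominated by the summable norms of the coefficients,
  so the continuous partial sums converge uniformly.\<close>

lemma continuous_on_fps_val:
  fixes F :: "'a::banach fps"
  assumes "F \<in> abs_summable_fps"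
  shows "continuous_on {-1..1} (fps_val F)"
proof -
  have "uniform_limit {-1..1} (\<lambda>n t. \<Sum>i<n. t ^ i *\<^sub>R (F $ i)) (\<lambda>t. \<Sum>i. t ^ i *\<^sub>R (F $ i)) sequentially"
    by (rule Weierstrass_m_test[of _ _ "\<lambda>n. norm (F $ n)"])
       (use assms in \<open>auto simp: abs_summable_fps_def abs_le_iff
          simp del: norm_scaleR intro!: norm_power_scaleR_le\<close>)
  then show ?thesis
    unfolding fps_val_def [abs_def]
    by (rule uniform_limit_theorem[rotated]) (auto intro!: always_eventually continuous_intros)
qed

text \<open>On \<open>K\<close> this is the definition of the supremum, and continuity carries it to
  the closure. The closure matters because the limit point 0 may lie outside
  \<open>K\<close>.\<close>

lemma norm_fps_val_le_norm_on:
  fixes F :: "'a::banach fps"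
  assumes "F \<in> abs_summable_fps" "K \<subseteq> {-1..1}" "t \<in> closure K"
  shows "norm (fps_val F t) \<le> norm_on K F"
proof (rule continuous_on_closure_norm_le[OF _ _ assms(3)])
  have "closure K \<subseteq> {-1..1}"
    using assms(2) by (simp add: closure_minimal)
  then show "continuous_on (closure K) (fps_val F)"
    using continuous_on_fps_val[OF assms(1)] continuous_on_subset by blast
  have "bdd_above ((\<lambda>t. norm (fps_val F t)) ` K)"
    using assms(1,2) by (intro bdd_aboveI2[of _ _ "\<Sum>n. norm (F $ n)"] norm_fps_val_le) (auto simp: abs_le_iff)
  then show "\<forall>s\<in>K. norm (fps_val F s) \<le> norm_on K F"
    unfolding norm_on_def by (auto intro: cSUP_upper2)
qed

lemma fps_val_0: "fps_val F 0 = (F $ 0 :: 'a::real_normed_vector)"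
proof -
  \<comment> \<open>The constant term survives because \<open>0 ^ 0 = 1\<close>.\<close>
  have "(\<lambda>n. 0 ^ n *\<^sub>R (F $ n)) sums (0 ^ 0 *\<^sub>R (F $ 0))"
    by (rule sums_finite[of "{0}", simplified]) auto
  then show ?thesis
    by (simp add: fps_val_def sums_iff)
qed

text \<open>The case \<open>m = 0\<close> yields the constants; the case \<open>m = 1\<close> yields
  the series \<open>a Z\<close> on which a supposed unit is tested.\<close>

lemma
  fixes a :: "'a::real_normed_vector"
  shows monomial_abs_summable: "Abs_fps (\<lambda>n. if n = m then a else 0) \<in> abs_summable_fps"
    and fps_val_monomial: "fps_val (Abs_fps (\<lambda>n. if n = m then a else 0)) t = t ^ m *\<^sub>R a"
proof -
  show "Abs_fps (\<lambda>n. if n = m then a else 0) \<in> abs_summable_fps"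
    unfolding abs_summable_fps_def by (auto intro!: summable_finite[of "{m}"] split: if_splits)
  have "(\<lambda>n. t ^ n *\<^sub>R (if n = m then a else 0)) = (\<lambda>n. if n = m then t ^ n *\<^sub>R a else 0)"
    by auto
  then show "fps_val (Abs_fps (\<lambda>n. if n = m then a else 0)) t = t ^ m *\<^sub>R a"
    using sums_single[of m "\<lambda>n. t ^ n *\<^sub>R a"] by (simp add: fps_val_def sums_iff)
qed

lemma fps_const_eq_monomial: "fps_const a = Abs_fps (\<lambda>n. if n = 0 then a else 0)"
  by (simp add: fps_const_def)

lemma fps_const_abs_summable: "fps_const (a :: 'a::real_normed_vector) \<in> abs_summable_fps"
  by (simp add: fps_const_eq_monomial monomial_abs_summable)

lemma fps_val_const: "fps_val (fps_const a) t = (a :: 'a::real_normed_vector)"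
  by (simp add: fps_const_eq_monomial fps_val_monomial)

lemma norm_on_const:
  assumes "K \<noteq> {}"
  shows "norm_on K (fps_const a) = norm a"
  using assms by (simp add: norm_on_def fps_val_const)

text \<open>Submultiplicativity gives \<open>norm x \<le> norm x * norm x\<close>, so a nonzero
  idempotent has norm at least 1.\<close>

lemma idempotent_eq_0:
  fixes x :: "'a::real_normed_algebra"
  assumes "x * x = x" "norm x < 1"
  shows "x = 0"
proof (rule ccontr)
  assume "x \<noteq> 0"
  then have "norm x * norm x < norm x"
    using assms(2) by simp
  then show False
    using norm_mult_ineq[of x x] assms(1) by simp
qed

theorem proposition7:
  fixes K :: "real set"
    and j :: "'a::cstar_algebra fps \<Rightarrow> 'e::cstar_algebra"
    and A_K A1_hat :: "'e set"
  assumes "K \<subseteq> {-1..1}"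
    and "0 islimpt K"
    and "cstar_completion abs_summable_fps (norm_on K) A_K j"
    and "A1_hat = closure (j ` abs_summable_fps1)"
  shows "(\<forall>F\<in>A_K. \<exists>!(a, G). G \<in> A1_hat \<and> F = j (fps_const a) + G) \<and>
         (\<forall>a. \<forall>G\<in>A1_hat. norm_on K (fps_const a) = norm a \<and> norm (j (fps_const a)) = norm a \<and>
            norm a \<le> norm (j (fps_const a) + G)) \<and>
         cstar_extension A_K (UNIV :: 'a set) A1_hat \<and>
         \<not> is_unital A1_hat"
proof -

  \<comment> \<open>Evaluation homomorphisms on the completion\<close>
  let ?V = "abs_summable_fps :: 'a fps set"
  have V: "star_subalgebra ?V"
    by (rule star_subalgebra_abs_summable_fps)
  have j: "star_hom_on ?V A_K j" and nj: "\<And>F. F \<in> ?V \<Longrightarrow> norm (j F) = norm_on K F"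
    and A_K: "closure (j ` ?V) = A_K"
    using assms(3) by (auto simp: cstar_completion_def)
  have subA_K: "cstar_subalgebra A_K"
    using closure_star_subalgebra[OF star_hom_on_image[OF j V]] A_K by simp
  have jV: "j F \<in> A_K" if "F \<in> ?V" for F
    using that A_K closure_subset[of "j ` ?V"] by auto
  have j1: "j F \<in> A1_hat" if "F \<in> abs_summable_fps1" for F
    using that assms(4) closure_subset[of "j ` abs_summable_fps1"] by auto
  have "K \<noteq> {}"
    using assms(2) by auto
  \<comment> \<open>This is applied twice: at 0, to split off the constant term, and at a nonzero
    point of \<open>K\<close> close to 0, to refute a unit.\<close>
  have ev: "\<exists>p. star_hom_on A_K UNIV p \<and> continuous_on A_K p \<and> (\<forall>F\<in>?V. p (j F) = fps_val F t) \<and>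
      (\<forall>y\<in>A_K. norm (p y) \<le> norm y)" if tK: "t \<in> closure K" for t
  proof -
    have "t \<in> {-1..1}"
      using closure_minimal[OF assms(1)] tK by auto
    then have t: "\<bar>t\<bar> \<le> 1"
      by auto
    obtain p where "star_hom_on A_K UNIV p" "continuous_on A_K p"
      "\<And>F. F \<in> ?V \<Longrightarrow> p (j F) = fps_val F t" "\<And>y. y \<in> A_K \<Longrightarrow> norm (p y) \<le> norm y"
      using star_hom_extends_to_completion[OF V assms(3) star_hom_on_fps_val[OF t]]
        norm_fps_val_le_norm_on[OF _ assms(1) tK] by metis
    then show ?thesis
      by blast
  qed
  have "0 \<in> closure K"
    using assms(2) by (simp add: closure_def)
  then obtain p where p: "star_hom_on A_K UNIV p" "continuous_on A_K p"
    "\<And>F. F \<in> ?V \<Longrightarrow> p (j F) = F $ 0" "\<And>y. y \<in> A_K \<Longrightarrow> norm (p y) \<le> norm y"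
    using ev[of 0] by (auto simp: fps_val_0)
  have A_K': "star_subalgebra A_K" "closed A_K"
    using subA_K by (auto simp: cstar_subalgebra_def)
  note p_diff = star_hom_on_diff[OF p(1) A_K'(1)]
  have p_add: "p (x + y) = p x + p y" if "x \<in> A_K" "y \<in> A_K" for x y
    using p(1) that by (simp add: star_hom_on_def)
  have jc: "j (fps_const a) \<in> A_K" "p (j (fps_const a)) = a" "norm (j (fps_const a)) = norm a" for a
    using jV[OF fps_const_abs_summable] nj[OF fps_const_abs_summable]
      p(3)[OF fps_const_abs_summable] norm_on_const[OF \<open>K \<noteq> {}\<close>] by simp_all

  \<comment> \<open>The ideal as the kernel of evaluation at 0\<close>
  have sub_ker: "A1_hat \<subseteq> {x \<in> A_K. p x = 0}"
    unfolding assms(4)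
  proof (rule closure_minimal)
    show "j ` abs_summable_fps1 \<subseteq> {x \<in> A_K. p x = 0}"
      using jV p(3) by (auto simp: abs_summable_fps1_def)
    show "closed {x \<in> A_K. p x = 0}"
      using continuous_closed_preimage_constant[OF p(2) A_K'(2)] .
  qed
  \<comment> \<open>Subtracting the constant part is a continuous map, since constants embed
    isometrically. It sends the dense image of the series into the closed set \<open>A1_hat\<close>,
    hence all of \<open>A_K\<close> as well.\<close>
  have remainder: "x - j (fps_const (p x)) \<in> A1_hat" if "x \<in> A_K" for x
  proof -
    have jdiff: "j (fps_const a) - j (fps_const b) = j (fps_const (a - b))" for a b
      using star_hom_on_diff[OF j V, of "fps_const a" "fps_const b"]
      by (simp add: fps_const_abs_summable)
    have "dist (j (fps_const a)) (j (fps_const b)) = dist a b" for a b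
      by (simp add: dist_norm jdiff jc)
    then have "continuous_on UNIV (\<lambda>a. j (fps_const a))"
      unfolding continuous_on_iff by auto
    then have "continuous_on A_K (\<lambda>x. j (fps_const (p x)))"
      using continuous_on_compose2 p(2) by blast
    then have cont: "continuous_on (closure (j ` ?V)) (\<lambda>x. x - j (fps_const (p x)))"
      unfolding A_K by (intro continuous_intros)
    have "j F - j (fps_const (p (j F))) \<in> A1_hat" if F: "F \<in> ?V" for F
    proof -
      have "F - fps_const (F $ 0) \<in> abs_summable_fps1"
        using star_subalgebra_diff[OF V F fps_const_abs_summable]
        by (simp add: abs_summable_fps1_def)
      then have "j (F - fps_const (F $ 0)) \<in> A1_hat"
        by (rule j1)
      then show ?thesis
        using star_hom_on_diff[OF j V F fps_const_abs_summable] p(3)[OF F] by simp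
    qed
    then have "(\<lambda>x. x - j (fps_const (p x))) ` closure (j ` ?V) \<subseteq> A1_hat"
      by (intro image_closure_subset[OF cont]) (auto simp: assms(4))
    then show ?thesis
      using that A_K by auto
  qed
  have j0: "j 0 = 0"
    by (rule star_hom_on_zero[OF j V])
  \<comment> \<open>For \<open>p x = 0\<close> the subtracted constant is \<open>j 0 = 0\<close>, so
    \<open>remainder\<close> puts \<open>x\<close> itself into \<open>A1_hat\<close>.\<close>
  have ker: "A1_hat = {x \<in> A_K. p x = 0}"
    using sub_ker remainder j0 by (force simp: fps_const_0_eq_0)

  \<comment> \<open>Decomposition, norm inequality and extension\<close>
  have "\<exists>!(a, G). G \<in> A1_hat \<and> F = j (fps_const a) + G" if F: "F \<in> A_K" for F
  proof (rule ex1I[of _ "(p F, F - j (fps_const (p F)))"])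
    show "case (p F, F - j (fps_const (p F))) of (a, G) \<Rightarrow> G \<in> A1_hat \<and> F = j (fps_const a) + G"
      using remainder[OF F] by simp
    \<comment> \<open>Applying \<open>p\<close> to a decomposition kills \<open>G\<close> and
      returns \<open>a\<close>; then \<open>G\<close> is determined too.\<close>
    show "aG = (p F, F - j (fps_const (p F)))"
      if "case aG of (a, G) \<Rightarrow> G \<in> A1_hat \<and> F = j (fps_const a) + G" for aG
      using that ker jc p_add by (auto split: prod.splits)
  qed
  \<comment> \<open>The contraction \<open>p\<close> maps the sum to \<open>a\<close>.\<close>
  moreover have "norm a \<le> norm (j (fps_const a) + G)" if "G \<in> A1_hat" for a G
  proof -
    have G: "G \<in> A_K" "p G = 0"
      using that ker by auto
    have "j (fps_const a) + G \<in> A_K"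
      using A_K'(1) jc(1) G(1) by (auto simp: star_subalgebra_def)
    then show ?thesis
      using p(4)[of "j (fps_const a) + G"] p_add[OF jc(1) G(1)] G(2) jc(2) by simp
  qed
  moreover have "cstar_extension A_K (UNIV :: 'a set) A1_hat"
    unfolding cstar_extension_def
  proof (intro conjI exI)
    show "cstar_subalgebra A_K"
      by fact
    show "cstar_subalgebra (UNIV :: 'a set)"
      by (simp add: cstar_subalgebra_def star_subalgebra_def)
    show "cstar_subalgebra A1_hat"
      using star_hom_on_kernel(1)[OF p(1) A_K'(1)]
      unfolding cstar_subalgebra_def ker[symmetric] by (simp add: assms(4))
    show "two_sided_ideal A1_hat A_K"
      using star_hom_on_kernel(2)[OF p(1) A_K'(1)] ker by simp
    \<comment> \<open>The exact sequence consists of the inclusion and evaluation at 0.\<close>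
    show "star_hom_on A1_hat A_K id"
      using ker by (auto simp: star_hom_on_def)
    show "p ` A_K = UNIV"
      using jc by (metis UNIV_eq_I image_eqI)
    show "id ` A1_hat = {x \<in> A_K. p x = 0}"
      using ker by simp
  qed (use p(1) in simp_all)

  \<comment> \<open>Absence of a unit\<close>
  moreover have "\<not> is_unital A1_hat"
  proof
    assume "is_unital A1_hat"
    then obtain e where e: "e \<in> A1_hat" "e \<noteq> 0" "\<And>x. x \<in> A1_hat \<Longrightarrow> e * x = x"
      unfolding is_unital_def by blast
    have eA: "e \<in> A_K"
      using e(1) ker by simp
    \<comment> \<open>The two halves add up to the bound \<open>norm (q e) < 1\<close>:
      \<open>q e\<close> will be within 1/2 of \<open>fps_val g t\<close>, which is itself below 1/2
      in norm for \<open>t\<close> near 0 because \<open>g\<close> vanishes at 0.\<close>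
    obtain g where g: "g \<in> abs_summable_fps1" "dist (j g) e < 1 / 2"
      using e(1) unfolding assms(4) closure_approachable
      by (metis half_gt_zero imageE zero_less_one)
    have gV: "g \<in> ?V" and g0: "fps_val g 0 = 0"
      using g(1) by (auto simp: abs_summable_fps1_def fps_val_0)
    obtain d where d: "d > 0" "\<And>t. t \<in> {-1..1} \<Longrightarrow> \<bar>t\<bar> < d \<Longrightarrow> norm (fps_val g t) < 1 / 2"
      using continuous_on_fps_val[OF gV, unfolded continuous_on_iff, rule_format, of 0 "1 / 2"] g0
      by (auto simp: dist_norm)
    \<comment> \<open>Being a limit point supplies a nonzero \<open>t\<close>, so that
      \<open>t\<close> can be cancelled from \<open>t a = 0\<close> below.\<close>
    obtain t where t: "t \<in> K" "t \<noteq> 0" "\<bar>t\<bar> < d"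
      using assms(2) d(1) unfolding islimpt_approachable by (auto simp: dist_norm)
    obtain q where q: "star_hom_on A_K UNIV q" "\<And>F. F \<in> ?V \<Longrightarrow> q (j F) = fps_val F t"
      "\<And>y. y \<in> A_K \<Longrightarrow> norm (q y) \<le> norm y"
      using ev[of t] t(1) closure_subset by blast
    have q_mult: "q (x * y) = q x * q y" if "x \<in> A_K" "y \<in> A_K" for x y
      using q(1) that by (simp add: star_hom_on_def)
    have "norm (q e - fps_val g t) \<le> norm (e - j g)"
      using q(3)[of "e - j g"] star_subalgebra_diff[OF A_K'(1) eA jV[OF gV]]
        star_hom_on_diff[OF q(1) A_K'(1) eA jV[OF gV]] q(2)[OF gV] by simp
    then have "norm (q e - fps_val g t) < 1 / 2"
      using g(2) by (simp add: dist_norm norm_minus_commute)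
    moreover have "norm (fps_val g t) < 1 / 2"
      using d(2) t assms(1) by blast
    ultimately have "norm (q e) < 1"
      using norm_triangle_sub[of "q e" "fps_val g t"] by simp
    moreover have "q e * q e = q e"
      using q_mult[OF eA eA] e(3)[OF e(1)] by simp
    ultimately have qe: "q e = 0"
      by (rule idempotent_eq_0[rotated])
    \<comment> \<open>As \<open>e\<close> fixes \<open>a Z\<close>, evaluation at \<open>t\<close>
      gives \<open>t a = q e * (t a)\<close>, which is 0 by \<open>qe\<close>.\<close>
    have zero: "a = 0" for a :: 'a
    proof -
      let ?Z = "Abs_fps (\<lambda>n. if n = 1 then a else 0)"
      have Z: "?Z \<in> abs_summable_fps1"
        using monomial_abs_summable[of 1 a] by (simp add: abs_summable_fps1_def)
      then have "j ?Z \<in> A1_hat"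
        by (rule j1)
      then have "q (j ?Z) = q e * q (j ?Z)"
        using e(3) q_mult[OF eA] ker by force
      then have "fps_val ?Z t = 0"
        using qe q(2) Z by (simp add: abs_summable_fps1_def)
      then show ?thesis
        using t(2) fps_val_monomial[of 1 a t] by simp
    qed
    \<comment> \<open>With trivial coefficients the ideal is zero, which is excluded because a unit
      is nonzero by definition.\<close>
    then have "F = 0" for F :: "'a fps"
      by (intro fps_ext) simp
    then have "j ` abs_summable_fps1 \<subseteq> {0}"
      using j0 by (metis image_subsetI insertI1)
    then have "A1_hat \<subseteq> {0}"
      unfolding assms(4) by (simp add: closure_minimal)
    then show False
      using e by blast
  qed
  ultimately show ?thesis
    using jc norm_on_const[OF \<open>K \<noteq> {}\<close>] by blast
qed

end
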